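(* Let $A_q\in\mathbb{R}^{n\times n}$ and $B_q\in\mathbb{R}^{n\times p}$, $q=1,2$, with $p=\operatorname{rk}B_1\ge m_2:=\operatorname{rk}B_2$ and $p+m_2\ge n+1$. Let $\Theta\subset\mathbb{C}\times\mathbb{C}$ be such that $\operatorname{rk}\begin{bmatrix}N_1(\lambda)&N_2(\mu)\end{bmatrix}=n$ for all $(\lambda,\mu)\in\Theta$, and let $(\lambda,\mu)\in\Theta$. With $N_1,N_2,\hat N$ as in the context, the following hold. (a) $\dim\big(\operatorname{im}N_1(\lambda)\cap\operatorname{im}N_2(\mu)\big)\ge 1$. (b) For $L_{12}\in\mathbb{C}^{p\times(2p-n)}$ and $L_{22}\in\mathbb{C}^{(n-p)\times(2p-n)}$ given by $$\begin{bmatrix}L_{12}\\ L_{22}\end{bmatrix}:=\hat N(\lambda,\mu)^{-1}\begin{bmatrix}N_1(\lambda)&N_2(\mu)\end{bmatrix}\begin{bmatrix}0\\ I_{2p-n}\end{bmatrix}$$ we have $L_{12}\ne0$ and $$\operatorname{im}N_1(\lambda)\cap\operatorname{im}N_2(\mu)=\operatorname{im}\hat N(\lambda,\mu)\begin{bmatrix}L_{12}\\ 0\end{bmatrix}.$$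
   Context: For the points $(\lambda,\mu)$ considered, $N_1(\lambda),N_2(\mu)\in\mathbb{C}^{n\times p}$ and $M_1(\lambda),M_2(\mu)\in\mathbb{C}^{p\times p}$ are matrices with $$\ker\begin{bmatrix}\lambda I-A_1&B_1\end{bmatrix}=\operatorname{im}\begin{bmatrix}N_1(\lambda)\\ M_1(\lambda)\end{bmatrix},\qquad\ker\begin{bmatrix}\mu I-A_2&B_2\end{bmatrix}=\operatorname{im}\begin{bmatrix}N_2(\mu)\\ M_2(\mu)\end{bmatrix}.$$ Define $$\hat N(\lambda,\mu):=\begin{bmatrix}N_1(\lambda)&N_2(\mu)\begin{bmatrix}I_{n-p}\\ 0\end{bmatrix}\end{bmatrix}\in\mathbb{C}^{n\times n},$$ i.e. $N_1(\lambda)$ together with the first $n-p$ columns of $N_2(\mu)$. It is assumed (by reordering columns, which is possible because of the rank condition) that $\hat N(\lambda,\mu)$ is invertible for $(\lambda,\mu)\in\Theta$. *)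

theory Defs
  imports
    Complex_Main
    "Jordan_Normal_Form.DL_Rank"
    "Jordan_Normal_Form.Gauss_Jordan_Elimination"
    "Jordan_Normal_Form.Matrix_Kernel"
begin

text \<open>Matrices are those of \<^theory>\<open>Jordan_Normal_Form.Matrix\<close>, because block sizes such as
  \<open>n - p\<close> and \<open>2 * p - n\<close> occur and \<open>n - p\<close> may be \<open>0\<close>.\<close>

text \<open>Block row \<open>[A B]\<close>, the counterpart of \<^const>\<open>append_rows\<close>; meaningful only if \<open>A\<close> and \<open>B\<close>
  have equally many rows.\<close>

definition append_cols :: "'a :: zero mat \<Rightarrow> 'a mat \<Rightarrow> 'a mat" (infixr \<open>@\<^sub>c\<close> 66) where
  "A @\<^sub>c B = four_block_mat A B (0\<^sub>m 0 (dim_col A)) (0\<^sub>m 0 (dim_col B))"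

definition mat_image :: "'a :: comm_ring_1 mat \<Rightarrow> 'a vec set" where
  "mat_image A = (\<lambda>v. A *\<^sub>v v) ` carrier_vec (dim_col A)"

text \<open>Dimension of a subspace \<open>W\<close> of \<open>K\<^sup>n\<close>; it is applied only to genuine subspaces.\<close>

definition subspace_dim :: "nat \<Rightarrow> 'a :: field vec set \<Rightarrow> nat" where
  "subspace_dim n W = vectorspace.dim class_ring ((module_vec TYPE('a) n)\<lparr>carrier := W\<rparr>)"

definition pencil :: "nat \<Rightarrow> real mat \<Rightarrow> real mat \<Rightarrow> complex \<Rightarrow> complex mat" where
  "pencil n A B z =
     (z \<cdot>\<^sub>m 1\<^sub>m n - map_mat complex_of_real A) @\<^sub>c map_mat complex_of_real B"

text \<open>\<open>N\<^sub>1\<close> followed by the first \<open>n - p\<close> columns of \<open>N\<^sub>2\<close>, for \<open>n \<times> p\<close> matrices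
  with \<open>p \<le> n \<le> 2 * p\<close>; the zero block below the identity has \<open>p - (n - p) = 2 * p - n\<close> rows.\<close>

definition N_hat :: "nat \<Rightarrow> nat \<Rightarrow> complex mat \<Rightarrow> complex mat \<Rightarrow> complex mat" where
  "N_hat n p N1 N2 = N1 @\<^sub>c (N2 * (1\<^sub>m (n - p) @\<^sub>r 0\<^sub>m (2 * p - n) (n - p)))"

end

theory Submission
  imports Defs
begin

text \<open>The kernel of \<open>[\<mu> I - A\<^sub>2  B\<^sub>2]\<close> has dimension at least \<open>p\<close>, so the \<open>p\<close> columns of
  \<open>N\<^sub>2\<close> stacked on \<open>M\<^sub>2\<close> are independent; as \<open>N\<^sub>2 w = 0\<close> implies \<open>B\<^sub>2 M\<^sub>2 w = 0\<close>,
  the matrix \<open>N\<^sub>2\<close> has rank at least \<open>m\<^sub>2\<close>. Since \<open>N\<^sub>1\<close> consists of columns of the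
  invertible \<open>N_hat\<close>, counting dimensions gives a nonzero vector in both images. By definition
  of \<open>L\<close>, the last \<open>2 p - n\<close> columns of \<open>N\<^sub>2\<close> are \<open>N\<^sub>1 L\<^sub>1\<^sub>2\<close> plus a combination of the
  first \<open>n - p\<close> ones, and invertibility of \<open>N_hat\<close> turns any common vector into some
  \<open>N\<^sub>1 L\<^sub>1\<^sub>2 c\<close>. Hence also \<open>L\<^sub>1\<^sub>2 \<noteq> 0\<close>.\<close>

section \<open>Matrices acting on block vectors\<close>

text \<open>A nonzero null vector exists exactly if the determinant vanishes, and transposition
  preserves the determinant. This turns a linear dependence between the rows into a null
  vector.\<close>

lemma null_vector_transpose:
  fixes A :: "'a :: field mat"
  assumes A: "A \<in> carrier_mat n n" and y: "y \<in> carrier_vec n" "y \<noteq> 0\<^sub>v n"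
    and "transpose_mat A *\<^sub>v y = 0\<^sub>v n"
  shows "\<exists>x \<in> carrier_vec n. x \<noteq> 0\<^sub>v n \<and> A *\<^sub>v x = 0\<^sub>v n"
  using assms det_transpose[OF A] det_0_iff_vec_prod_zero_field[OF A]
    det_0_iff_vec_prod_zero_field[of "transpose_mat A" n]
  by auto

lemma append_cols_carrier [simp, intro]:
  assumes "A \<in> carrier_mat nr nc1" "B \<in> carrier_mat nr nc2"
  shows "A @\<^sub>c B \<in> carrier_mat nr (nc1 + nc2)"
  using assms unfolding append_cols_def by auto

lemma append_cols_mult_vec:
  fixes A B :: "'a :: comm_ring_1 mat"
  assumes A: "A \<in> carrier_mat nr nc1" and B: "B \<in> carrier_mat nr nc2"
    and a: "a \<in> carrier_vec nc1" and b: "b \<in> carrier_vec nc2"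
  shows "(A @\<^sub>c B) *\<^sub>v (a @\<^sub>v b) = A *\<^sub>v a + B *\<^sub>v b"
proof -
  \<comment> \<open>The lower blocks of \<open>append_cols\<close> have no rows, so the general
    block product only carries an empty vector below the wanted sum.\<close>
  have "(A @\<^sub>c B) *\<^sub>v (a @\<^sub>v b)
      = (A *\<^sub>v a + B *\<^sub>v b) @\<^sub>v (0\<^sub>m 0 nc1 *\<^sub>v a + 0\<^sub>m 0 nc2 *\<^sub>v b)"
    unfolding append_cols_def using A B a b by (subst four_block_mat_mult_vec) auto
  then show ?thesis
    using A B by (auto intro!: eq_vecI)
qed

lemma transpose_append_rows:
  assumes "A \<in> carrier_mat nr1 nc" "B \<in> carrier_mat nr2 nc"
  shows "transpose_mat (A @\<^sub>r B) = transpose_mat A @\<^sub>c transpose_mat B"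
  using assms unfolding append_rows_def append_cols_def
  by (intro eq_matI) auto

lemma append_zero_vec: "0\<^sub>v m @\<^sub>v 0\<^sub>v k = 0\<^sub>v (m + k)"
  by (intro eq_vecI) auto

lemma append_vec_eq_zero_iff:
  assumes "a \<in> carrier_vec m" "b \<in> carrier_vec k"
  shows "a @\<^sub>v b = 0\<^sub>v (m + k) \<longleftrightarrow> a = 0\<^sub>v m \<and> b = 0\<^sub>v k"
  unfolding append_zero_vec[symmetric] using assms by (intro append_vec_eq) auto

lemma append_vec_assoc: "(a @\<^sub>v b) @\<^sub>v c = a @\<^sub>v (b @\<^sub>v c)"
  by (intro eq_vecI) auto

lemma append_vec_cases:
  assumes "v \<in> carrier_vec (m + k)"
  obtains a b where "a \<in> carrier_vec m" "b \<in> carrier_vec k" "v = a @\<^sub>v b"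
  using that vec_first_last_append[OF assms] vec_first_carrier vec_last_carrier by metis

lemma zero_mult_vec:
  fixes v :: "'a :: comm_ring_1 vec"
  assumes "v \<in> carrier_vec nc"
  shows "0\<^sub>m nr nc *\<^sub>v v = 0\<^sub>v nr"
  using assms by (intro eq_vecI) auto

lemma mult_zero_vec:
  fixes A :: "'a :: comm_ring_1 mat"
  assumes "A \<in> carrier_mat nr nc"
  shows "A *\<^sub>v 0\<^sub>v nc = 0\<^sub>v nr"
  using assms by (intro eq_vecI) (auto simp: scalar_prod_def)

lemma minus_vec_eq_zeroD:
  fixes v w :: "'a :: comm_ring_1 vec"
  assumes "v - w = 0\<^sub>v n" "v \<in> carrier_vec n" "w \<in> carrier_vec n"
  shows "v = w"
proof (rule eq_vecI)
  fix i assume i: "i < dim_vec w"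
  have "(v - w) $ i = 0"
    using assms i by simp
  then show "v $ i = w $ i"
    using i by simp
qed (use assms in auto)

section \<open>Null vectors from counting rows and columns\<close>

text \<open>Padding with \<open>k\<close> zero rows makes the matrix square. A unit vector supported
  on the padding is a null vector of the transpose, so the padded matrix has a nonzero null vector,
  which \<open>A\<close> kills as well.\<close>

lemma underdetermined_null_vector:
  fixes A :: "'a :: field mat"
  assumes A: "A \<in> carrier_mat nr nc" and "nr < nc"
  shows "\<exists>x \<in> carrier_vec nc. x \<noteq> 0\<^sub>v nc \<and> A *\<^sub>v x = 0\<^sub>v nr"
proof -
  define k where "k = nc - nr"
  have nc: "nc = nr + k" and "0 < k"
    using \<open>nr < nc\<close> by (auto simp: k_def)
  let ?S = "A @\<^sub>r 0\<^sub>m k nc"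
  have S: "?S \<in> carrier_mat nc nc"
    using carrier_append_rows[OF A zero_carrier_mat[of k nc]] nc by simp
  have "transpose_mat ?S *\<^sub>v (0\<^sub>v nr @\<^sub>v unit_vec k 0)
      = transpose_mat A *\<^sub>v 0\<^sub>v nr + 0\<^sub>m nc k *\<^sub>v unit_vec k 0"
    using A by (subst transpose_append_rows[of _ nr nc _ k])
      (auto intro!: append_cols_mult_vec[of _ nc nr _ k])
  also have "\<dots> = 0\<^sub>v nc"
    using A by (subst zero_mult_vec) auto
  finally have "transpose_mat ?S *\<^sub>v (0\<^sub>v nr @\<^sub>v unit_vec k 0) = 0\<^sub>v nc" .
  moreover have "0\<^sub>v nr @\<^sub>v unit_vec k 0 \<noteq> (0\<^sub>v nc :: 'a vec)"
    using \<open>0 < k\<close> unfolding nc by (subst append_vec_eq_zero_iff) auto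
  moreover have "0\<^sub>v nr @\<^sub>v unit_vec k 0 \<in> carrier_vec nc"
    unfolding nc by auto
  ultimately obtain x where x: "x \<in> carrier_vec nc" "x \<noteq> 0\<^sub>v nc" "?S *\<^sub>v x = 0\<^sub>v nc"
    using null_vector_transpose[OF S] by metis
  have "(A *\<^sub>v x) @\<^sub>v (0\<^sub>m k nc *\<^sub>v x) = 0\<^sub>v (nr + k)"
    using x(3) mat_mult_append[OF A zero_carrier_mat x(1), of k] nc by simp
  then have "A *\<^sub>v x = 0\<^sub>v nr"
    using A x(1) by (subst (asm) append_vec_eq_zero_iff) (auto simp: zero_mult_vec)
  with x show ?thesis by blast
qed

text \<open>A null vector of \<open>F\<close> makes the rows of \<open>P\<close> stacked on \<open>F\<^sup>*\<close> linearly
  dependent, so some \<open>x \<noteq> 0\<close> lies in the kernel of \<open>P\<close> and is orthogonal to the image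
  of \<open>F\<close>; but that kernel is the image of \<open>F\<close>.\<close>

lemma kernel_generators_injective:
  fixes P F :: "complex mat"
  assumes P: "P \<in> carrier_mat m (m + k)" and F: "F \<in> carrier_mat (m + k) k"
    and kernel: "mat_kernel P = mat_image F"
    and w: "w \<in> carrier_vec k" "F *\<^sub>v w = 0\<^sub>v (m + k)"
  shows "w = 0\<^sub>v k"
proof (rule ccontr)
  assume "w \<noteq> 0\<^sub>v k"
  define G where "G = mat k (m + k) (\<lambda>(i, j). conjugate (F $$ (j, i)))"
  have G: "G \<in> carrier_mat k (m + k)"
    by (simp add: G_def)
  have adj: "(G *\<^sub>v x) \<bullet>c u = x \<bullet>c (F *\<^sub>v u)" if "x \<in> carrier_vec (m + k)" "u \<in> carrier_vec k" for x u
  proof -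
    have "(G *\<^sub>v x) \<bullet>c u = (\<Sum>i<k. \<Sum>j<m+k. cnj (F $$ (j, i)) * x $ j * cnj (u $ i))"
      using that by (simp add: G_def scalar_prod_def lessThan_atLeast0 sum_distrib_right)
    also have "\<dots> = (\<Sum>j<m+k. \<Sum>i<k. cnj (F $$ (j, i)) * x $ j * cnj (u $ i))"
      by (rule sum.swap)
    also have "\<dots> = x \<bullet>c (F *\<^sub>v u)"
      using that F by (simp add: scalar_prod_def lessThan_atLeast0 sum_distrib_left mult_ac)
    finally show ?thesis .
  qed
  \<comment> \<open>Conjugating \<open>F w = 0\<close> shows that \<open>conjugate w\<close> is a
    null vector of the transpose of \<open>G\<close>, that is, a dependence between the rows of
    \<open>G\<close>.\<close>
  let ?y = "0\<^sub>v m @\<^sub>v conjugate w"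
  have A: "P @\<^sub>r G \<in> carrier_mat (m + k) (m + k)"
    using P G by auto
  have "transpose_mat (P @\<^sub>r G) *\<^sub>v ?y = transpose_mat P *\<^sub>v 0\<^sub>v m + transpose_mat G *\<^sub>v conjugate w"
    unfolding transpose_append_rows[OF P G] using P G w(1) by (intro append_cols_mult_vec) auto
  also have "transpose_mat P *\<^sub>v 0\<^sub>v m = 0\<^sub>v (m + k)"
    using P by auto
  also have "transpose_mat G *\<^sub>v conjugate w = conjugate (F *\<^sub>v w)"
    using F w(1) by (intro eq_vecI) (auto simp: G_def scalar_prod_def)
  also have "\<dots> = 0\<^sub>v (m + k)"
    using w(2) by simp
  finally have "transpose_mat (P @\<^sub>r G) *\<^sub>v ?y = 0\<^sub>v (m + k)"
    by simp
  moreover have "?y \<in> carrier_vec (m + k)" "?y \<noteq> 0\<^sub>v (m + k)"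
    using w(1) \<open>w \<noteq> 0\<^sub>v k\<close> by (auto simp: append_vec_eq_zero_iff)
  ultimately obtain x where x: "x \<in> carrier_vec (m + k)" "x \<noteq> 0\<^sub>v (m + k)"
      and Ax: "(P @\<^sub>r G) *\<^sub>v x = 0\<^sub>v (m + k)"
    using null_vector_transpose[OF A] by metis
  have Px: "P *\<^sub>v x = 0\<^sub>v m" and Gx: "G *\<^sub>v x = 0\<^sub>v k"
    using Ax P G x(1) unfolding mat_mult_append[OF P G x(1)]
    by (auto simp: append_vec_eq_zero_iff)
  obtain u where u: "u \<in> carrier_vec k" "x = F *\<^sub>v u"
    using mat_kernelI[OF P x(1) Px] F unfolding kernel mat_image_def by auto
  \<comment> \<open>As \<open>x = F u\<close>, the adjoint identity turns the product of
    \<open>x\<close> with itself into that of \<open>G x = 0\<close> with \<open>u\<close>. The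
    conjugated product is definite, which contradicts \<open>x\<close> being nonzero.\<close>
  have "x \<bullet>c x = 0"
    using adj[OF x(1) u(1)] u Gx by simp
  then show False
    using x by simp
qed

section \<open>Rank through independent columns\<close>

text \<open>A maximal independent set of columns has as many elements as the rank. \<open>E\<close>
  selects these columns, and their independence is the injectivity of \<open>C * E\<close>. This
  puts the rank in a form fit for counting dimensions.\<close>

lemma rank_column_selection:
  fixes C :: "'a :: field mat"
  assumes C: "C \<in> carrier_mat n nc"
  shows "\<exists>E \<in> carrier_mat nc (vec_space.rank n C).
    \<forall>v \<in> carrier_vec (vec_space.rank n C). C *\<^sub>v (E *\<^sub>v v) = 0\<^sub>v n \<longrightarrow> v = 0\<^sub>v (vec_space.rank n C)"
proof -
  interpret vec_space "TYPE('a)" n .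
  obtain S where S: "maximal S (\<lambda>T. T \<subseteq> set (cols C) \<and> lin_indpt T)"
    using maximal_exists[of "\<lambda>T. T \<subseteq> set (cols C) \<and> lin_indpt T" "card (set (cols C))" "{}"]
    by (meson List.finite_set card_mono empty_iff empty_subsetI finite_lin_indpt2 rev_finite_subset)
  then have sub: "S \<subseteq> set (cols C)" and ind: "lin_indpt S"
    by (auto simp: maximal_def)
  obtain ws where ws: "set ws = S" "distinct ws"
    using finite_distinct_list[OF finite_subset[OF sub]] by auto
  define r where "r = rank C"
  have len: "length ws = r"
    using rank_card_indpt[OF C S] ws distinct_card[OF ws(2)] by (simp add: r_def)
  have "\<forall>j<r. \<exists>i<nc. ws ! j = col C i"
  proof (intro allI impI)
    fix j assume "j < r"
    then have "ws ! j \<in> set (cols C)"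
      using ws sub len nth_mem by blast
    then show "\<exists>i<nc. ws ! j = col C i"
      using C by (auto simp: cols_def)
  qed
  then obtain f where f: "\<And>j. j < r \<Longrightarrow> f j < nc \<and> ws ! j = col C (f j)"
    by metis
  \<comment> \<open>Column \<open>j\<close> of \<open>E\<close> is the unit vector at
    \<open>f j\<close>, so \<open>C * E\<close> lists the selected columns
    \<open>ws\<close>.\<close>
  define E :: "'a mat" where "E = mat nc r (\<lambda>(i, j). if i = f j then 1 else 0)"
  have E: "E \<in> carrier_mat nc r"
    by (simp add: E_def)
  have ws_carrier: "set ws \<subseteq> carrier_vec n"
    using ws sub cols_dim[of C] C by auto
  have CE: "C * E = mat_of_cols n ws"
  proof (rule eq_matI)
    fix i j assume "i < dim_row (mat_of_cols n ws)" "j < dim_col (mat_of_cols n ws)"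
    then have ij: "i < n" "j < r"
      using len by auto
    have "(C * E) $$ (i, j) = (\<Sum>k = 0..<nc. C $$ (i, k) * (if k = f j then 1 else 0))"
      using C ij by (simp add: E_def scalar_prod_def)
    also have "\<dots> = (\<Sum>k = 0..<nc. if k = f j then C $$ (i, k) else 0)"
      by (rule sum.cong) auto
    also have "\<dots> = C $$ (i, f j)"
      using f[OF ij(2)] by simp
    also have "\<dots> = mat_of_cols n ws $$ (i, j)"
      using ij f[OF ij(2)] len C by (simp add: mat_of_cols_index)
    finally show "(C * E) $$ (i, j) = mat_of_cols n ws $$ (i, j)" .
  qed (use C E len in auto)
  have "v = 0\<^sub>v r" if v: "v \<in> carrier_vec r" and 0: "C *\<^sub>v (E *\<^sub>v v) = 0\<^sub>v n" for v
  proof (rule ccontr)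
    assume "v \<noteq> 0\<^sub>v r"
    have cols: "cols (mat_of_cols n ws) = ws"
      using ws_carrier by (rule cols_mat_of_cols)
    have "mat_of_cols n ws *\<^sub>v v = 0\<^sub>v n"
      unfolding CE[symmetric] using assoc_mult_mat_vec[OF C E v] 0 by simp
    then have "lin_dep S"
      using lin_depI[of "mat_of_cols n ws" r v] v \<open>v \<noteq> 0\<^sub>v r\<close> len ws cols by auto
    with ind show False by simp
  qed
  with E show ?thesis
    unfolding r_def by blast
qed

text \<open>Were the rank larger than \<open>n\<close>, \<open>C * E\<close> would be injective with
  more columns than rows.\<close>

lemma rank_le_nr:
  fixes C :: "'a :: field mat"
  assumes C: "C \<in> carrier_mat n nc"
  shows "vec_space.rank n C \<le> n"
proof (rule ccontr)
  let ?r = "vec_space.rank n C"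
  assume "\<not> ?r \<le> n"
  obtain E where E: "E \<in> carrier_mat nc ?r"
      and inj: "\<And>v. v \<in> carrier_vec ?r \<Longrightarrow> C *\<^sub>v (E *\<^sub>v v) = 0\<^sub>v n \<Longrightarrow> v = 0\<^sub>v ?r"
    using rank_column_selection[OF C] by blast
  obtain v where "v \<in> carrier_vec ?r" "v \<noteq> 0\<^sub>v ?r" "(C * E) *\<^sub>v v = 0\<^sub>v n"
    using underdetermined_null_vector[OF mult_carrier_mat[OF C E]] \<open>\<not> ?r \<le> n\<close> by auto
  then show False
    using inj assoc_mult_mat_vec[OF C E] by metis
qed

text \<open>The entries of \<open>D\<close> are real, so the real and imaginary parts of a complex
  null vector are null vectors too. This carries injectivity from the reals, where the rank of
  \<open>B2\<close> is taken, to the complex numbers, where \<open>N2\<close> and \<open>M2\<close>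
  live.\<close>

lemma complexify_mult_vec_injective:
  fixes D :: "real mat"
  assumes D: "D \<in> carrier_mat n m"
    and inj: "\<And>v. v \<in> carrier_vec m \<Longrightarrow> D *\<^sub>v v = 0\<^sub>v n \<Longrightarrow> v = 0\<^sub>v m"
    and v: "v \<in> carrier_vec m" and 0: "map_mat complex_of_real D *\<^sub>v v = 0\<^sub>v n"
  shows "v = 0\<^sub>v m"
proof -
  have eq: "(\<Sum>j = 0..<m. complex_of_real (D $$ (i, j)) * v $ j) = 0" if "i < n" for i
    using arg_cong[OF 0, of "\<lambda>x. x $ i"] that D v by (simp add: scalar_prod_def)
  have "D *\<^sub>v map_vec Re v = 0\<^sub>v n"
  proof (rule eq_vecI)
    fix i assume "i < dim_vec (0\<^sub>v n :: real vec)"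
    then show "(D *\<^sub>v map_vec Re v) $ i = 0\<^sub>v n $ i"
      using arg_cong[OF eq[of i], of Re] D v by (simp add: scalar_prod_def)
  qed (use D in auto)
  moreover have "D *\<^sub>v map_vec Im v = 0\<^sub>v n"
  proof (rule eq_vecI)
    fix i assume "i < dim_vec (0\<^sub>v n :: real vec)"
    then show "(D *\<^sub>v map_vec Im v) $ i = 0\<^sub>v n $ i"
      using arg_cong[OF eq[of i], of Im] D v by (simp add: scalar_prod_def)
  qed (use D in auto)
  ultimately have "map_vec Re v = 0\<^sub>v m" "map_vec Im v = 0\<^sub>v m"
    using inj v by auto
  then have "Re (v $ j) = 0" "Im (v $ j) = 0" if "j < m" for j
    using that v by (metis carrier_vecD index_map_vec(1) index_zero_vec(1))+
  then show ?thesis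
    using v by (intro eq_vecI) (auto simp: complex_eq_iff)
qed

section \<open>Dimensions, images and inverses\<close>

text \<open>A maximal independent subset of \<open>W\<close> is a finite basis, and it is nonempty
  because \<open>x\<close> lies outside the span of the empty set.\<close>

lemma subspace_dim_pos:
  fixes W :: "'a :: field vec set"
  assumes sub: "submodule class_ring W (module_vec TYPE('a) n)"
    and x: "x \<in> W" "x \<noteq> 0\<^sub>v n"
  shows "subspace_dim n W \<ge> 1"
proof -
  interpret V: vec_space "TYPE('a)" n .
  have subsp: "subspace class_ring W V.V"
    using sub V.vectorspace_axioms by (auto simp: subspace_def)
  interpret W: vectorspace class_ring "V.vs W"
    using V.subspace_is_vs[OF subsp] .
  \<comment> \<open>Independence inside \<open>W\<close> implies independence in the ambient space,
    whose dimension \<open>n\<close> bounds every independent set. This guarantees a finite maximal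
    one.\<close>
  have small: "finite A \<and> card A \<le> n" if "A \<subseteq> W" "W.lin_indpt A" for A
  proof -
    have "V.lin_indpt A"
      using that V.span_li_not_depend(2)[OF that(1) sub] by simp
    moreover have "A \<subseteq> carrier_vec n"
      using that sub by (auto simp: submodule_def module_vec_simps)
    ultimately show ?thesis
      using V.li_le_dim V.dim_is_n by auto
  qed
  obtain A where A: "finite A" "maximal A (\<lambda>S. S \<subseteq> carrier (V.vs W) \<and> W.lin_indpt S)"
    using maximal_exists[of "\<lambda>S. S \<subseteq> carrier (V.vs W) \<and> W.lin_indpt S" n "{}"] small
    by (auto simp: W.lin_dep_def)
  then have basis: "W.basis A"
    by (intro W.max_li_is_basis)
  have "A \<noteq> {}"
  proof
    assume "A = {}"
    then have "W = {0\<^sub>v n}"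
      using basis W.span_empty by (auto simp: W.basis_def module_vec_simps)
    with x show False by auto
  qed
  then have "W.dim \<ge> 1"
    using W.dim_basis[OF A(1) basis] A(1) by (simp add: Suc_le_eq card_gt_0_iff)
  then show ?thesis
    by (simp add: subspace_dim_def)
qed

lemma mat_image_carrier:
  assumes "A \<in> carrier_mat n nc"
  shows "mat_image A = (\<lambda>v. A *\<^sub>v v) ` carrier_vec nc"
  using assms by (simp add: mat_image_def)

lemma mat_image_submodule:
  fixes A :: "'a :: field mat"
  assumes A: "A \<in> carrier_mat n nc"
  shows "submodule class_ring (mat_image A) (module_vec TYPE('a) n)"
proof -
  have "0\<^sub>v n \<in> mat_image A"
    unfolding mat_image_carrier[OF A] using A by (intro image_eqI[of _ _ "0\<^sub>v nc"]) auto
  moreover have "v + w \<in> mat_image A" if "v \<in> mat_image A" "w \<in> mat_image A" for v w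
    using that unfolding mat_image_carrier[OF A]
    by (auto simp: mult_add_distrib_mat_vec[OF A, symmetric])
  moreover have "c \<cdot>\<^sub>v v \<in> mat_image A" if "v \<in> mat_image A" for c v
    using that unfolding mat_image_carrier[OF A]
    by (auto simp: mult_mat_vec[OF A, symmetric])
  moreover have "mat_image A \<subseteq> carrier_vec n"
    unfolding mat_image_carrier[OF A] using A by auto
  ultimately show ?thesis
    using vec_module by (auto simp: submodule_def module_vec_simps)
qed

lemma submodule_Int:
  assumes "submodule R U M" "submodule R W M"
  shows "submodule R (U \<inter> W) M"
  using assms by (auto simp: submodule_def)

text \<open>An invertible matrix is a unit of the matrix ring, on which \<open>mat_inverse\<close>
  succeeds. Hence the \<open>the\<close> in the equation for \<open>L12\<close> and
  \<open>L22\<close> yields a genuine inverse.\<close>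

lemma mat_inverse_invertible:
  fixes A :: "'a :: field mat"
  assumes A: "A \<in> carrier_mat n n" and inv: "invertible_mat A"
  obtains B where "mat_inverse A = Some B" "A * B = 1\<^sub>m n" "B * A = 1\<^sub>m n" "B \<in> carrier_mat n n"
proof -
  obtain B where B: "A * B = 1\<^sub>m n" "B * A = 1\<^sub>m (dim_row B)"
    using inv A unfolding invertible_mat_def inverts_mat_def by auto
  \<comment> \<open>Invertibility leaves the size of \<open>B\<close> open; comparing dimensions in
    the two identities fixes it.\<close>
  have "dim_row B = n"
    using arg_cong[OF B(2), of dim_col] A by simp
  moreover have "dim_col B = n"
    using arg_cong[OF B(1), of dim_col] by simp
  ultimately have "A \<in> Units (ring_mat TYPE('a) n ())"
    using A B by (auto simp: Units_def ring_mat_simps)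
  then obtain B where "mat_inverse A = Some B"
    using mat_inverse(1)[OF A, of "()"] by auto
  then show ?thesis
    using that mat_inverse(2)[OF A] by blast
qed

section \<open>The pencil and nonzero common image vectors\<close>

lemma pencil_carrier:
  assumes "A \<in> carrier_mat n n" "B \<in> carrier_mat n p"
  shows "pencil n A B z \<in> carrier_mat n (n + p)"
  using assms unfolding pencil_def by (intro append_cols_carrier) auto

text \<open>A vector with zero upper part meets only the block \<open>B\<close>. So a kernel vector
  of the pencil with vanishing upper part has its lower part in the kernel of
  \<open>B\<close>.\<close>

lemma pencil_mult_zero_vec:
  assumes A: "A \<in> carrier_mat n n" and B: "B \<in> carrier_mat n p" and y: "y \<in> carrier_vec p"
  shows "pencil n A B z *\<^sub>v (0\<^sub>v n @\<^sub>v y) = map_mat complex_of_real B *\<^sub>v y"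
proof -
  have Z: "z \<cdot>\<^sub>m 1\<^sub>m n - map_mat complex_of_real A \<in> carrier_mat n n"
    using A by auto
  have "(z \<cdot>\<^sub>m 1\<^sub>m n - map_mat complex_of_real A) *\<^sub>v 0\<^sub>v n = 0\<^sub>v n"
    using mult_zero_vec[OF Z] .
  moreover have "map_mat complex_of_real B *\<^sub>v y \<in> carrier_vec n"
    using B by (auto intro!: mult_mat_vec_carrier y)
  ultimately show ?thesis
    unfolding pencil_def using append_cols_mult_vec[OF Z _ zero_carrier_vec y] B by simp
qed

text \<open>The equations \<open>N\<^sub>1 a = N\<^sub>2 w\<close> and \<open>M w = E d\<close> have \<open>n + p\<close> rows and
  \<open>2 p + r\<close> unknowns. In a nonzero solution \<open>N\<^sub>1 a \<noteq> 0\<close>: otherwise \<open>a = 0\<close>,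
  \<open>B (E d) = B (M w) = 0\<close> forces \<open>d = 0\<close>, and then \<open>w = 0\<close>.\<close>

lemma image_Int_nontrivial:
  fixes N1 N2 M B E :: "'a :: field mat"
  assumes N1: "N1 \<in> carrier_mat n p" and N2: "N2 \<in> carrier_mat n p"
    and M: "M \<in> carrier_mat p p" and E: "E \<in> carrier_mat p r"
    and "n < p + r"
    and N1_inj: "\<And>a. a \<in> carrier_vec p \<Longrightarrow> N1 *\<^sub>v a = 0\<^sub>v n \<Longrightarrow> a = 0\<^sub>v p"
    and NM_inj: "\<And>w. w \<in> carrier_vec p \<Longrightarrow> N2 *\<^sub>v w = 0\<^sub>v n \<Longrightarrow> M *\<^sub>v w = 0\<^sub>v p \<Longrightarrow> w = 0\<^sub>v p"
    and BM: "\<And>w. w \<in> carrier_vec p \<Longrightarrow> N2 *\<^sub>v w = 0\<^sub>v n \<Longrightarrow> B *\<^sub>v (M *\<^sub>v w) = 0\<^sub>v n"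
    and BE_inj: "\<And>d. d \<in> carrier_vec r \<Longrightarrow> B *\<^sub>v (E *\<^sub>v d) = 0\<^sub>v n \<Longrightarrow> d = 0\<^sub>v r"
  shows "\<exists>x \<in> mat_image N1 \<inter> mat_image N2. x \<noteq> 0\<^sub>v n"
proof -
  \<comment> \<open>The unknown is \<open>(a, w, d)\<close>, and \<open>?T\<close> maps it to
    \<open>N1 a - N2 w\<close> stacked on \<open>M w - E d\<close>.\<close>
  let ?U = "N1 @\<^sub>c (- N2)" and ?L = "0\<^sub>m p p @\<^sub>c M"
  let ?T = "four_block_mat ?U (0\<^sub>m n r) ?L (- E)"
  have U: "?U \<in> carrier_mat n (p + p)" and L: "?L \<in> carrier_mat p (p + p)"
    using N1 N2 M by auto
  have T: "?T \<in> carrier_mat (n + p) (p + p + r)"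
    using U E by (intro four_block_carrier_mat) auto
  obtain v where v: "v \<in> carrier_vec (p + p + r)" "v \<noteq> 0\<^sub>v (p + p + r)" "?T *\<^sub>v v = 0\<^sub>v (n + p)"
    using underdetermined_null_vector[OF T] \<open>n < p + r\<close> by auto
  obtain aw d where d: "aw \<in> carrier_vec (p + p)" "d \<in> carrier_vec r" "v = aw @\<^sub>v d"
    using append_vec_cases[OF v(1)] by blast
  obtain a w where aw: "a \<in> carrier_vec p" "w \<in> carrier_vec p" "aw = a @\<^sub>v w"
    using append_vec_cases[OF d(1)] by blast
  note carriers = mult_mat_vec_carrier[OF N1 aw(1)] mult_mat_vec_carrier[OF N2 aw(2)]
    mult_mat_vec_carrier[OF M aw(2)] mult_mat_vec_carrier[OF E d(2)]
  have "?T *\<^sub>v v = (?U *\<^sub>v aw + 0\<^sub>m n r *\<^sub>v d) @\<^sub>v (?L *\<^sub>v aw + (- E) *\<^sub>v d)"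
    unfolding d(3) using U L E d by (intro four_block_mat_mult_vec) auto
  also have "?U *\<^sub>v aw = N1 *\<^sub>v a + (- N2) *\<^sub>v w"
    unfolding aw(3) using N1 N2 aw by (intro append_cols_mult_vec) auto
  also have "?L *\<^sub>v aw = 0\<^sub>m p p *\<^sub>v a + M *\<^sub>v w"
    unfolding aw(3) using M aw by (intro append_cols_mult_vec) auto
  finally have "(N1 *\<^sub>v a - N2 *\<^sub>v w) @\<^sub>v (M *\<^sub>v w - E *\<^sub>v d) = 0\<^sub>v (n + p)"
    using v(3) N2 E aw d carriers
    by (simp add: zero_mult_vec minus_add_uminus_vec[of _ n] minus_add_uminus_vec[of _ p])
  then have diffs: "N1 *\<^sub>v a - N2 *\<^sub>v w = 0\<^sub>v n" "M *\<^sub>v w - E *\<^sub>v d = 0\<^sub>v p"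
    using carriers by (simp_all add: append_vec_eq_zero_iff)
  have eqs: "N1 *\<^sub>v a = N2 *\<^sub>v w" "M *\<^sub>v w = E *\<^sub>v d"
    using diffs carriers by (auto intro: minus_vec_eq_zeroD)
  have "N1 *\<^sub>v a \<noteq> 0\<^sub>v n"
  proof
    assume 0: "N1 *\<^sub>v a = 0\<^sub>v n"
    then have "a = 0\<^sub>v p" using N1_inj aw by blast
    moreover have "d = 0\<^sub>v r"
      using 0 BM[OF aw(2)] BE_inj[OF d(2)] eqs by simp
    moreover from this have "w = 0\<^sub>v p"
      using 0 NM_inj[OF aw(2)] eqs mult_zero_vec[OF E] by simp
    ultimately show False
      using v(2) d aw by (simp add: append_zero_vec)
  qed
  moreover have "N1 *\<^sub>v a \<in> mat_image N1" "N1 *\<^sub>v a \<in> mat_image N2"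
    unfolding mat_image_carrier[OF N1] mat_image_carrier[OF N2] using eqs(1) aw(1,2) by blast+
  ultimately show ?thesis by blast
qed

section \<open>The matrix \<open>N_hat\<close> and the formula for the intersection\<close>

lemma N_hat_carrier:
  assumes "N1 \<in> carrier_mat n p" "N2 \<in> carrier_mat n p" "p \<le> n" "n \<le> 2 * p"
  shows "N_hat n p N1 N2 \<in> carrier_mat n n"
proof -
  \<comment> \<open>For \<open>p \<le> n \<le> 2 * p\<close> the truncated subtractions are exact,
    so the selector has \<open>(n - p) + (2 * p - n) = p\<close> rows and fits
    \<open>N2\<close>.\<close>
  have "1\<^sub>m (n - p) @\<^sub>r 0\<^sub>m (2 * p - n) (n - p) \<in> carrier_mat ((n - p) + (2 * p - n)) (n - p)"
    by auto
  then have "N2 * (1\<^sub>m (n - p) @\<^sub>r 0\<^sub>m (2 * p - n) (n - p)) \<in> carrier_mat n (n - p)"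
    using assms by (intro mult_carrier_mat[OF assms(2)]) simp
  from append_cols_carrier[OF assms(1) this] show ?thesis
    using assms by (simp add: N_hat_def)
qed

text \<open>Keeping the first \<open>n - p\<close> columns of \<open>N2\<close> amounts to filling
  up their coefficients with \<open>2 * p - n\<close> zeros.\<close>

lemma N_hat_mult_vec:
  assumes N1: "N1 \<in> carrier_mat n p" and N2: "N2 \<in> carrier_mat n p"
    and le: "p \<le> n" "n \<le> 2 * p"
    and a: "a \<in> carrier_vec p" and b: "b \<in> carrier_vec (n - p)"
  shows "N_hat n p N1 N2 *\<^sub>v (a @\<^sub>v b) = N1 *\<^sub>v a + N2 *\<^sub>v (b @\<^sub>v 0\<^sub>v (2 * p - n))"
proof -
  let ?S = "1\<^sub>m (n - p) @\<^sub>r 0\<^sub>m (2 * p - n) (n - p) :: complex mat"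
  have "?S \<in> carrier_mat ((n - p) + (2 * p - n)) (n - p)"
    by auto
  then have S: "?S \<in> carrier_mat p (n - p)"
    using le by simp
  have Sb: "?S *\<^sub>v b = b @\<^sub>v 0\<^sub>v (2 * p - n)"
    using b by (subst mat_mult_append[OF _ zero_carrier_mat]) (auto simp: zero_mult_vec)
  show ?thesis
    unfolding N_hat_def Sb[symmetric] assoc_mult_mat_vec[OF N2 S b, symmetric]
    using N1 N2 S a b by (intro append_cols_mult_vec) auto
qed

text \<open>Write \<open>H\<close> for \<open>N_hat n p N1 N2\<close>. The equation for
  \<open>L12\<close> and \<open>L22\<close> says
  \<open>N2 (0, c) = N1 (L12 c) + N2 (L22 c, 0)\<close>, which puts \<open>N1 (L12 c)\<close> into
  the image of \<open>N2\<close>. Conversely, if \<open>N1 a = N2 (b, c)\<close>, the same identity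
  gives \<open>H (a, 0) = H (L12 c, b + L22 c)\<close>, and injectivity of \<open>H\<close> yields
  \<open>a = L12 c\<close>.\<close>

lemma image_Int_eq_N_hat_image:
  assumes N1: "N1 \<in> carrier_mat n p" and N2: "N2 \<in> carrier_mat n p"
    and le: "p \<le> n" "n \<le> 2 * p"
    and inv: "invertible_mat (N_hat n p N1 N2)"
    and L12: "L12 \<in> carrier_mat p (2 * p - n)" and L22: "L22 \<in> carrier_mat (n - p) (2 * p - n)"
    and L: "L12 @\<^sub>r L22 = the (mat_inverse (N_hat n p N1 N2)) * (N1 @\<^sub>c N2)
      * (0\<^sub>m n (2 * p - n) @\<^sub>r 1\<^sub>m (2 * p - n))"
  shows "mat_image N1 \<inter> mat_image N2
    = mat_image (N_hat n p N1 N2 * (L12 @\<^sub>r 0\<^sub>m (n - p) (2 * p - n)))"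
proof -
  define q where "q = 2 * p - n"
  define H where "H = N_hat n p N1 N2"
  have sizes: "(n - p) + q = p" "n + q = p + p" "p + (n - p) = n"
    using le by (auto simp: q_def)
  have H: "H \<in> carrier_mat n n"
    unfolding H_def using N1 N2 le by (rule N_hat_carrier)
  obtain J where J: "mat_inverse H = Some J" "H * J = 1\<^sub>m n" "J * H = 1\<^sub>m n" "J \<in> carrier_mat n n"
    using mat_inverse_invertible[OF H] inv unfolding H_def by blast
  have L12': "L12 \<in> carrier_mat p q" and L22': "L22 \<in> carrier_mat (n - p) q"
    using L12 L22 by (auto simp: q_def)
  have H_mult: "H *\<^sub>v (a @\<^sub>v b) = N1 *\<^sub>v a + N2 *\<^sub>v (b @\<^sub>v 0\<^sub>v q)"
    if "a \<in> carrier_vec p" "b \<in> carrier_vec (n - p)" for a b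
    unfolding H_def q_def using N_hat_mult_vec[OF N1 N2 le that] .
  have N12: "N1 @\<^sub>c N2 \<in> carrier_mat n (p + p)"
    using N1 N2 by auto
  have tail: "0\<^sub>m n q @\<^sub>r 1\<^sub>m q \<in> carrier_mat (p + p) q"
    using carrier_append_rows[of "0\<^sub>m n q" n q "1\<^sub>m q" q] sizes by simp
  have pad_left: "0\<^sub>v (n - p) @\<^sub>v c \<in> carrier_vec p" if "c \<in> carrier_vec q" for c :: "complex vec"
    using append_carrier_vec[OF zero_carrier_vec that, of "n - p"] sizes(1) by simp
  have pad_right: "b @\<^sub>v 0\<^sub>v q \<in> carrier_vec p" if "b \<in> carrier_vec (n - p)" for b :: "complex vec"
    using append_carrier_vec[OF that zero_carrier_vec, of q] sizes(1) by simp
  \<comment> \<open>Left multiplication by \<open>H\<close> cancels the inverse \<open>J\<close> in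
    the equation for the stacked matrix.\<close>
  have last_cols: "N1 *\<^sub>v (L12 *\<^sub>v c) + N2 *\<^sub>v ((L22 *\<^sub>v c) @\<^sub>v 0\<^sub>v q) = N2 *\<^sub>v (0\<^sub>v (n - p) @\<^sub>v c)"
    if c: "c \<in> carrier_vec q" for c
  proof -
    have "H *\<^sub>v ((L12 *\<^sub>v c) @\<^sub>v (L22 *\<^sub>v c)) = H *\<^sub>v ((L12 @\<^sub>r L22) *\<^sub>v c)"
      using mat_mult_append[OF L12' L22' c] by simp
    also have "(L12 @\<^sub>r L22) *\<^sub>v c = J *\<^sub>v ((N1 @\<^sub>c N2) *\<^sub>v ((0\<^sub>m n q @\<^sub>r 1\<^sub>m q) *\<^sub>v c))"
      using L J(1) assoc_mult_mat_vec[OF mult_carrier_mat[OF J(4) N12] tail c]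
        assoc_mult_mat_vec[OF J(4) N12 mult_mat_vec_carrier[OF tail c]]
      unfolding H_def[symmetric] q_def[symmetric] by simp
    also have "(0\<^sub>m n q @\<^sub>r 1\<^sub>m q) *\<^sub>v c = 0\<^sub>v n @\<^sub>v c"
      using c by (subst mat_mult_append[OF zero_carrier_mat]) (auto simp: zero_mult_vec)
    \<comment> \<open>The \<open>n\<close> zeros are regrouped as \<open>p + (n - p)\<close>: the
      first \<open>p\<close> meet \<open>N1\<close>, the others, followed by \<open>c\<close>, meet
      \<open>N2\<close>.\<close>
    also have "0\<^sub>v n @\<^sub>v c = 0\<^sub>v p @\<^sub>v (0\<^sub>v (n - p) @\<^sub>v c)"
      using sizes(3) by (simp add: append_vec_assoc[symmetric] append_zero_vec)
    also have "(N1 @\<^sub>c N2) *\<^sub>v (0\<^sub>v p @\<^sub>v (0\<^sub>v (n - p) @\<^sub>v c))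
        = N1 *\<^sub>v 0\<^sub>v p + N2 *\<^sub>v (0\<^sub>v (n - p) @\<^sub>v c)"
      using append_cols_mult_vec[OF N1 N2 zero_carrier_vec pad_left[OF c]] .
    also have "\<dots> = N2 *\<^sub>v (0\<^sub>v (n - p) @\<^sub>v c)"
      using mult_zero_vec[OF N1] mult_mat_vec_carrier[OF N2 pad_left[OF c]] by simp
    also have "H *\<^sub>v (J *\<^sub>v \<dots>) = (H * J) *\<^sub>v \<dots>"
      using assoc_mult_mat_vec[OF H J(4) mult_mat_vec_carrier[OF N2 pad_left[OF c]]] by simp
    also have "\<dots> = N2 *\<^sub>v (0\<^sub>v (n - p) @\<^sub>v c)"
      unfolding J(2) using mult_mat_vec_carrier[OF N2 pad_left[OF c]] by simp
    finally show ?thesis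
      using H_mult[of "L12 *\<^sub>v c" "L22 *\<^sub>v c"] L12' L22' c by simp
  qed
  have L0: "L12 @\<^sub>r 0\<^sub>m (n - p) q \<in> carrier_mat n q"
    using carrier_append_rows[OF L12' zero_carrier_mat[of "n - p" q]] sizes by simp
  have image: "(H * (L12 @\<^sub>r 0\<^sub>m (n - p) q)) *\<^sub>v c = N1 *\<^sub>v (L12 *\<^sub>v c)" if c: "c \<in> carrier_vec q" for c
  proof -
    have "(H * (L12 @\<^sub>r 0\<^sub>m (n - p) q)) *\<^sub>v c = H *\<^sub>v ((L12 *\<^sub>v c) @\<^sub>v 0\<^sub>v (n - p))"
      using assoc_mult_mat_vec[OF H L0 c] mat_mult_append[OF L12' zero_carrier_mat c] c
      by (simp add: zero_mult_vec)
    also have "\<dots> = N1 *\<^sub>v (L12 *\<^sub>v c) + N2 *\<^sub>v 0\<^sub>v p"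
      using H_mult[of "L12 *\<^sub>v c" "0\<^sub>v (n - p)"] L12' c sizes(1) by (simp add: append_zero_vec)
    also have "\<dots> = N1 *\<^sub>v (L12 *\<^sub>v c)"
      using N1 N2 L12' c by auto
    finally show ?thesis .
  qed
  have image_set: "mat_image (H * (L12 @\<^sub>r 0\<^sub>m (n - p) q)) = (\<lambda>c. N1 *\<^sub>v (L12 *\<^sub>v c)) ` carrier_vec q"
    unfolding mat_image_carrier[OF mult_carrier_mat[OF H L0]] using image by auto
  have split_sub: "N2 *\<^sub>v (b @\<^sub>v c) = N2 *\<^sub>v (b @\<^sub>v 0\<^sub>v q) + N2 *\<^sub>v (0\<^sub>v (n - p) @\<^sub>v c)"
    if "b \<in> carrier_vec (n - p)" "c \<in> carrier_vec q" for b c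
  proof -
    have "N2 *\<^sub>v ((b @\<^sub>v 0\<^sub>v q) + (0\<^sub>v (n - p) @\<^sub>v c))
        = N2 *\<^sub>v (b @\<^sub>v 0\<^sub>v q) + N2 *\<^sub>v (0\<^sub>v (n - p) @\<^sub>v c)"
      using mult_add_distrib_mat_vec[OF N2 pad_right[OF that(1)] pad_left[OF that(2)]] .
    then show ?thesis
      using that by (simp add: append_vec_add[of _ "n - p" _ _ q])
  qed
  have "mat_image N1 \<inter> mat_image N2 = (\<lambda>c. N1 *\<^sub>v (L12 *\<^sub>v c)) ` carrier_vec q"
  proof (intro equalityI subsetI)
    fix x assume "x \<in> (\<lambda>c. N1 *\<^sub>v (L12 *\<^sub>v c)) ` carrier_vec q"
    then obtain c where c: "c \<in> carrier_vec q" "x = N1 *\<^sub>v (L12 *\<^sub>v c)" by auto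
    define y where "y = (L22 *\<^sub>v c) @\<^sub>v 0\<^sub>v q"
    define z where "z = 0\<^sub>v (n - p) @\<^sub>v c"
    have yz: "y \<in> carrier_vec p" "z \<in> carrier_vec p"
      unfolding y_def z_def
      using pad_right[OF mult_mat_vec_carrier[OF L22' c(1)]] pad_left[OF c(1)] .
    \<comment> \<open>Solving \<open>last_cols\<close> for \<open>x\<close> produces the preimage
      \<open>z - y\<close> under \<open>N2\<close>.\<close>
    have "x = x + N2 *\<^sub>v y - N2 *\<^sub>v y"
      using c(2) N1 N2 by (intro eq_vecI) auto
    also have "\<dots> = N2 *\<^sub>v z - N2 *\<^sub>v y"
      using last_cols[OF c(1)] c(2) by (simp add: y_def z_def)
    also have "\<dots> = N2 *\<^sub>v (z - y)"
      using mult_minus_distrib_mat_vec[OF N2 yz(2,1)] by simp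
    finally have "x = N2 *\<^sub>v (z - y)" .
    then show "x \<in> mat_image N1 \<inter> mat_image N2"
      unfolding mat_image_carrier[OF N1] mat_image_carrier[OF N2]
      using c(2) mult_mat_vec_carrier[OF L12' c(1)] minus_carrier_vec[OF yz(2,1)] by blast
  next
    fix x assume "x \<in> mat_image N1 \<inter> mat_image N2"
    then obtain a v where a: "a \<in> carrier_vec p" "x = N1 *\<^sub>v a" and v: "v \<in> carrier_vec p" "x = N2 *\<^sub>v v"
      unfolding mat_image_carrier[OF N1] mat_image_carrier[OF N2] by auto
    obtain b c where bc: "b \<in> carrier_vec (n - p)" "c \<in> carrier_vec q" "v = b @\<^sub>v c"
      using append_vec_cases[of v "n - p" q] v(1) sizes(1) by metis
    \<comment> \<open>These are the coordinates of \<open>N2 (b, c)\<close> with respect to the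
      columns of \<open>H\<close>, found by replacing \<open>N2 (0, c)\<close> through
      \<open>last_cols\<close>.\<close>
    let ?l = "L12 *\<^sub>v c" and ?b' = "b + L22 *\<^sub>v c"
    have l: "?l \<in> carrier_vec p" and b': "?b' \<in> carrier_vec (n - p)"
      using L12' L22' bc by auto
    have "?b' @\<^sub>v 0\<^sub>v q = (b @\<^sub>v 0\<^sub>v q) + ((L22 *\<^sub>v c) @\<^sub>v 0\<^sub>v q)"
      using bc L22' by (simp add: append_vec_add[of _ "n - p" _ _ q])
    then have "N2 *\<^sub>v (?b' @\<^sub>v 0\<^sub>v q) = N2 *\<^sub>v (b @\<^sub>v 0\<^sub>v q) + N2 *\<^sub>v ((L22 *\<^sub>v c) @\<^sub>v 0\<^sub>v q)"
      using mult_add_distrib_mat_vec[OF N2 pad_right pad_right, of b "L22 *\<^sub>v c"] bc L22' by simp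
    then have "H *\<^sub>v (?l @\<^sub>v ?b') = N1 *\<^sub>v ?l + (N2 *\<^sub>v (b @\<^sub>v 0\<^sub>v q) + N2 *\<^sub>v ((L22 *\<^sub>v c) @\<^sub>v 0\<^sub>v q))"
      using H_mult[OF l b'] by simp
    also have "\<dots> = N2 *\<^sub>v (b @\<^sub>v 0\<^sub>v q) + (N1 *\<^sub>v ?l + N2 *\<^sub>v ((L22 *\<^sub>v c) @\<^sub>v 0\<^sub>v q))"
      using N1 N2 by (intro eq_vecI) auto
    also have "\<dots> = N2 *\<^sub>v (b @\<^sub>v c)"
      using last_cols[OF bc(2)] split_sub[OF bc(1,2)] by simp
    also have "\<dots> = N1 *\<^sub>v a"
      using a v bc by simp
    also have "\<dots> = H *\<^sub>v (a @\<^sub>v 0\<^sub>v (n - p))"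
      using H_mult[OF a(1), of "0\<^sub>v (n - p)"] mult_zero_vec[OF N2] mult_mat_vec_carrier[OF N1 a(1)] sizes(1)
      by (simp add: append_zero_vec)
    finally have eq: "H *\<^sub>v (?l @\<^sub>v ?b') = H *\<^sub>v (a @\<^sub>v 0\<^sub>v (n - p))" .
    have "?l @\<^sub>v ?b' \<in> carrier_vec n" "a @\<^sub>v 0\<^sub>v (n - p) \<in> carrier_vec n"
      using append_carrier_vec[OF l b'] append_carrier_vec[OF a(1) zero_carrier_vec[of "n - p"]] sizes(3)
      by simp_all
    then have "?l @\<^sub>v ?b' = a @\<^sub>v 0\<^sub>v (n - p)"
      using arg_cong[OF eq, of "\<lambda>u. J *\<^sub>v u"] J(3)
      by (simp add: assoc_mult_mat_vec[OF J(4) H, symmetric])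
    then have "a = ?l"
      using append_vec_eq[OF l a(1)] by simp
    then show "x \<in> (\<lambda>c. N1 *\<^sub>v (L12 *\<^sub>v c)) ` carrier_vec q"
      using a(2) bc(2) by blast
  qed
  then show ?thesis
    using image_set by (simp add: H_def q_def)
qed

section \<open>Dimension bound and image formula at a point of \<open>\<Theta>\<close>\<close>

theorem corollary5p2:
  fixes n p m2 :: nat
    and A1 A2 B1 B2 :: "real mat"
    and N1 N2 M1 M2 :: "complex \<Rightarrow> complex mat"
    and \<Theta> :: "(complex \<times> complex) set"
    and lam mu :: complex
  assumes "A1 \<in> carrier_mat n n" and "A2 \<in> carrier_mat n n"
    and "B1 \<in> carrier_mat n p" and "B2 \<in> carrier_mat n p"
    and "p = vec_space.rank n B1" and "m2 = vec_space.rank n B2"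
    and "p \<ge> m2" and "p + m2 \<ge> n + 1"
    and "\<And>z w. (z, w) \<in> \<Theta> \<Longrightarrow>
           N1 z \<in> carrier_mat n p \<and> M1 z \<in> carrier_mat p p \<and>
           mat_kernel (pencil n A1 B1 z) = mat_image (N1 z @\<^sub>r M1 z)"
    and "\<And>z w. (z, w) \<in> \<Theta> \<Longrightarrow>
           N2 w \<in> carrier_mat n p \<and> M2 w \<in> carrier_mat p p \<and>
           mat_kernel (pencil n A2 B2 w) = mat_image (N2 w @\<^sub>r M2 w)"
    and "\<And>z w. (z, w) \<in> \<Theta> \<Longrightarrow> vec_space.rank n (N1 z @\<^sub>c N2 w) = n"
    and "\<And>z w. (z, w) \<in> \<Theta> \<Longrightarrow> invertible_mat (N_hat n p (N1 z) (N2 w))"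
    and "(lam, mu) \<in> \<Theta>"
  shows "subspace_dim n (mat_image (N1 lam) \<inter> mat_image (N2 mu)) \<ge> 1 \<and>
    (\<forall>L12 \<in> carrier_mat p (2 * p - n). \<forall>L22 \<in> carrier_mat (n - p) (2 * p - n).
       L12 @\<^sub>r L22 =
         the (mat_inverse (N_hat n p (N1 lam) (N2 mu))) * (N1 lam @\<^sub>c N2 mu)
           * (0\<^sub>m n (2 * p - n) @\<^sub>r 1\<^sub>m (2 * p - n)) \<longrightarrow>
       L12 \<noteq> 0\<^sub>m p (2 * p - n) \<and>
       mat_image (N1 lam) \<inter> mat_image (N2 mu) =
         mat_image (N_hat n p (N1 lam) (N2 mu) * (L12 @\<^sub>r 0\<^sub>m (n - p) (2 * p - n))))"
proof -
  note B2 = assms(4)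
  have N1: "N1 lam \<in> carrier_mat n p"
    using assms(9,13) by blast
  have N2: "N2 mu \<in> carrier_mat n p" and M2: "M2 mu \<in> carrier_mat p p"
    and kernel2: "mat_kernel (pencil n A2 B2 mu) = mat_image (N2 mu @\<^sub>r M2 mu)"
    using assms(10,13) by blast+
  have inv: "invertible_mat (N_hat n p (N1 lam) (N2 mu))"
    using assms(12,13) by blast
  \<comment> \<open>The rank \<open>p\<close> of a matrix with \<open>n\<close> rows is at most
    \<open>n\<close>, and \<open>n + 1 \<le> p + m2 \<le> 2 * p\<close> gives the other
    bound.\<close>
  have le: "p \<le> n" "n \<le> 2 * p"
    using rank_le_nr[OF assms(3)] assms(5,7,8) by auto
  have H: "N_hat n p (N1 lam) (N2 mu) \<in> carrier_mat n n"
    using N_hat_carrier[OF N1 N2 le] .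
  have F: "N2 mu @\<^sub>r M2 mu \<in> carrier_mat (n + p) p"
    using N2 M2 by auto
  have P: "pencil n A2 B2 mu \<in> carrier_mat n (n + p)"
    using pencil_carrier[OF assms(2) B2] .
  let ?B = "map_mat complex_of_real B2"
  \<comment> \<open>\<open>E\<close> is chosen over the reals, since \<open>m2\<close> is the rank
    of the real matrix \<open>B2\<close>; its complexification \<open>?E\<close> enters the
    dimension count.\<close>
  obtain E where E: "E \<in> carrier_mat p m2"
      and E_inj: "\<And>v. v \<in> carrier_vec m2 \<Longrightarrow> B2 *\<^sub>v (E *\<^sub>v v) = 0\<^sub>v n \<Longrightarrow> v = 0\<^sub>v m2"
    using rank_column_selection[OF B2] assms(6) by blast
  let ?E = "map_mat complex_of_real E"
  have B: "?B \<in> carrier_mat n p" and E': "?E \<in> carrier_mat p m2"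
    using B2 E by auto
  have "\<exists>x \<in> mat_image (N1 lam) \<inter> mat_image (N2 mu). x \<noteq> 0\<^sub>v n"
  proof (rule image_Int_nontrivial[OF N1 N2 M2 E', of ?B])
    show "n < p + m2"
      using assms(8) by simp
  next
    fix a assume a: "a \<in> carrier_vec p" "N1 lam *\<^sub>v a = 0\<^sub>v n"
    obtain J where J: "J * N_hat n p (N1 lam) (N2 mu) = 1\<^sub>m n" "J \<in> carrier_mat n n"
      using mat_inverse_invertible[OF H inv] by blast
    \<comment> \<open>Padded with zeros, \<open>a\<close> becomes a coefficient vector for
      \<open>N_hat\<close>, and the left inverse \<open>J\<close> forces it to vanish.\<close>
    have v: "a @\<^sub>v 0\<^sub>v (n - p) \<in> carrier_vec n"
      using append_carrier_vec[OF a(1) zero_carrier_vec[of "n - p"]] le by simp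
    have "N_hat n p (N1 lam) (N2 mu) *\<^sub>v (a @\<^sub>v 0\<^sub>v (n - p)) = 0\<^sub>v n"
      using N_hat_mult_vec[OF N1 N2 le a(1), of "0\<^sub>v (n - p)"] a(2) mult_zero_vec[OF N2] le
      by (simp add: append_zero_vec)
    then have "a @\<^sub>v 0\<^sub>v (n - p) = J *\<^sub>v 0\<^sub>v n"
      using assoc_mult_mat_vec[OF J(2) H v] J(1) v by simp
    also have "\<dots> = 0\<^sub>v (p + (n - p))"
      using J(2) le by auto
    finally show "a = 0\<^sub>v p"
      using a by (simp add: append_vec_eq_zero_iff)
  next
    fix w assume w: "w \<in> carrier_vec p" "N2 mu *\<^sub>v w = 0\<^sub>v n" "M2 mu *\<^sub>v w = 0\<^sub>v p"
    show "w = 0\<^sub>v p"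
      by (rule kernel_generators_injective[OF P F kernel2 w(1)])
        (simp add: mat_mult_append[OF N2 M2 w(1)] w append_zero_vec)
  next
    fix w assume w: "w \<in> carrier_vec p" "N2 mu *\<^sub>v w = 0\<^sub>v n"
    \<comment> \<open>\<open>N2 w\<close> stacked on \<open>M2 w\<close> is a kernel vector of the
      pencil; as \<open>N2 w = 0\<close>, only the block \<open>B2\<close> acts on it.\<close>
    have "(N2 mu @\<^sub>r M2 mu) *\<^sub>v w \<in> mat_kernel (pencil n A2 B2 mu)"
      unfolding kernel2 mat_image_carrier[OF F] using w by blast
    then have "pencil n A2 B2 mu *\<^sub>v (0\<^sub>v n @\<^sub>v (M2 mu *\<^sub>v w)) = 0\<^sub>v n"
      using mat_kernelD(2)[OF P] mat_mult_append[OF N2 M2 w(1)] w(2) by simp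
    then show "?B *\<^sub>v (M2 mu *\<^sub>v w) = 0\<^sub>v n"
      using pencil_mult_zero_vec[OF assms(2) B2, of "M2 mu *\<^sub>v w"] M2 w(1) by simp
  next
    fix d assume d: "d \<in> carrier_vec m2" "?B *\<^sub>v (?E *\<^sub>v d) = 0\<^sub>v n"
    \<comment> \<open>Complexification commutes with products, so injectivity of the real matrix
      \<open>B2 * E\<close> settles the claim.\<close>
    have "map_mat complex_of_real (B2 * E) *\<^sub>v d = 0\<^sub>v n"
      unfolding of_real_hom.mat_hom_mult[OF B2 E]
      using d assoc_mult_mat_vec[OF B E' d(1)] by simp
    then show "d = 0\<^sub>v m2"
      using complexify_mult_vec_injective[OF mult_carrier_mat[OF B2 E] _ d(1)]
        E_inj assoc_mult_mat_vec[OF B2 E] by metis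
  qed
  then obtain x where x: "x \<in> mat_image (N1 lam) \<inter> mat_image (N2 mu)" "x \<noteq> 0\<^sub>v n"
    by blast
  have "subspace_dim n (mat_image (N1 lam) \<inter> mat_image (N2 mu)) \<ge> 1"
    using subspace_dim_pos[OF submodule_Int[OF mat_image_submodule[OF N1] mat_image_submodule[OF N2]] x] .
  \<comment> \<open>If \<open>L12\<close> were zero, the image formula would shrink the intersection
    to the zero vector, contrary to \<open>x\<close>.\<close>
  moreover have "L12 \<noteq> 0\<^sub>m p (2 * p - n)"
    if eq: "mat_image (N1 lam) \<inter> mat_image (N2 mu)
      = mat_image (N_hat n p (N1 lam) (N2 mu) * (L12 @\<^sub>r 0\<^sub>m (n - p) (2 * p - n)))" for L12
  proof
    assume 0: "L12 = 0\<^sub>m p (2 * p - n)"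
    have "0\<^sub>m p (2 * p - n) @\<^sub>r 0\<^sub>m (n - p) (2 * p - n) = (0\<^sub>m n (2 * p - n) :: complex mat)"
      using le by (intro eq_matI) (auto simp: append_rows_def)
    then have "N_hat n p (N1 lam) (N2 mu) * (L12 @\<^sub>r 0\<^sub>m (n - p) (2 * p - n)) = 0\<^sub>m n (2 * p - n)"
      using 0 H by simp
    then have "x \<in> mat_image (0\<^sub>m n (2 * p - n))"
      using x(1) eq by simp
    then have "x = 0\<^sub>v n"
      by (auto simp: mat_image_def zero_mult_vec)
    with x(2) show False ..
  qed
  ultimately show ?thesis
    using image_Int_eq_N_hat_image[OF N1 N2 le inv] by metis
qed

end
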